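(* Let $\mathcal{A}^+$ be the set of $\eta$-sequences, let $\mathcal{T}_n$ be the set of triangulations by non-intersecting diagonals of a convex $n$-gon with vertices labelled (in cyclic order) by $1,\dots,n$, and let $\mathcal{T}=\bigcup_{n=3}^\infty\mathcal{T}_n$. Let $\Psi:\mathcal{A}^+\to\mathcal{T}$ be the map sending an $\eta$-sequence $(c_1,\dots,c_n)$ to the triangulation of the $n$-gon which has exactly $c_i$ triangles attached to the vertex $i$, for each $i\in\{1,\dots,n\}$. Then $\Psi$ is bijective.
   Context: The $\eta$-sequences are the finite sequences of positive integers defined recursively as follows: (1) $(1,1,1)$ is an $\eta$-sequence. (2) If $(c_1,\dots,c_n)$ is an $\eta$-sequence, then $(c_2,c_3,\dots,c_n,c_1)$ and $(c_n,c_{n-1},\dots,c_2,c_1)$ are $\eta$-sequences. (3) If $(c_1,\dots,c_n)$ is an $\eta$-sequence, then $(c_1+1,1,c_2+1,c_3,\dots,c_n)$ is an $\eta$-sequence. (4) Every $\eta$-sequence is obtained recursively by (1), (2), (3). A triangle of a triangulation is attached to the vertex $i$ if $i$ is one of its corners. The map $\Psi$ sends $(1,1,1)$ to the triangle; inserting a $1$ as in (3) corresponds to attaching a new triangle at the edge $(1,2)$ (with relabelling), and (2) corresponds to the natural action of the dihedral group on the labelled polygon; in particular $\Psi$ is well-defined. *)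

theory Defs
  imports Main
begin

inductive_set eta_sequences :: "nat list set" where
  base: "[1, 1, 1] \<in> eta_sequences"
| rotate: "c \<in> eta_sequences \<Longrightarrow> rotate1 c \<in> eta_sequences"
| reflect: "c \<in> eta_sequences \<Longrightarrow> rev c \<in> eta_sequences"
| insert_one: "a # b # c \<in> eta_sequences \<Longrightarrow> (a + 1) # 1 # (b + 1) # c \<in> eta_sequences"

text \<open>The vertices of the convex \<open>n\<close>-gon are \<open>1, \<dots>, n\<close> in cyclic order; a side or a diagonal is
  the two-element set of its end points.\<close>

definition polygon_sides :: "nat \<Rightarrow> nat set set" where
  "polygon_sides n = {{i, i + 1} | i. 1 \<le> i \<and> i < n} \<union> {{n, 1}}"

definition polygon_diagonals :: "nat \<Rightarrow> nat set set" where
  "polygon_diagonals n = {d. d \<subseteq> {1..n} \<and> card d = 2} - polygon_sides n"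

text \<open>Two diagonals of a convex polygon meet in an interior point iff their end points
  alternate along the boundary. Diagonals with a common end point do not cross.\<close>

definition crossing :: "nat set \<Rightarrow> nat set \<Rightarrow> bool" where
  "crossing d e \<longleftrightarrow>
    (\<exists>i j k l. i < j \<and> j < k \<and> k < l \<and>
       (d = {i, k} \<and> e = {j, l} \<or> d = {j, l} \<and> e = {i, k}))"

text \<open>A triangulation is given by its set of diagonals: a maximal set of pairwise
  non-crossing diagonals.\<close>

definition triangulations_of :: "nat \<Rightarrow> nat set set set" where
  "triangulations_of n =
    {D. D \<subseteq> polygon_diagonals n \<and>
        (\<forall>d\<in>D. \<forall>e\<in>D. \<not> crossing d e) \<and>
        (\<forall>d\<in>polygon_diagonals n. (\<forall>e\<in>D. \<not> crossing d e) \<longrightarrow> d \<in> D)}"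

text \<open>All vertices of the polygon lie on its boundary, so three vertices that are pairwise joined
  by sides or by diagonals of the triangulation always bound one of its triangles.\<close>

definition triangles :: "nat \<Rightarrow> nat set set \<Rightarrow> nat set set" where
  "triangles n D =
    {t. t \<subseteq> {1..n} \<and> card t = 3 \<and>
        (\<forall>e. e \<subseteq> t \<and> card e = 2 \<longrightarrow> e \<in> polygon_sides n \<union> D)}"

definition attached :: "nat \<Rightarrow> nat set set \<Rightarrow> nat \<Rightarrow> nat set set" where
  "attached n D i = {t \<in> triangles n D. i \<in> t}"

text \<open>The number \<open>n\<close> of vertices is kept as part of the data, so that the union over \<open>n\<close> is disjoint.\<close>

definition triangulations :: "(nat \<times> nat set set) set" where
  "triangulations = (SIGMA n : {3..}. triangulations_of n)"

text \<open>List positions start at 0, vertex labels at 1.\<close>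

definition realizes :: "nat set set \<Rightarrow> nat list \<Rightarrow> bool" where
  "realizes D c \<longleftrightarrow>
    D \<in> triangulations_of (length c) \<and>
    (\<forall>i\<in>{1..length c}. card (attached (length c) D i) = c ! (i - 1))"

definition Psi :: "nat list \<Rightarrow> nat \<times> nat set set" where
  "Psi c = (length c, THE D. realizes D c)"

end

theory Submission
  imports Defs
begin

text \<open>By minimality of its length, a shortest diagonal \<open>{i, k}\<close> of a triangulation of an \<open>n\<close>-gon with
  \<open>n \<ge> 4\<close> has a vertex without diagonals right after \<open>i\<close>, so there is an ear. Conversely a vertex
  with a diagonal has at least two triangles, hence an entry \<open>1\<close> forces an ear. Cutting the ear off
  undoes the insertion of a \<open>1\<close>. Since both the \<open>\<eta>\<close>-sequences and the triangulations are closed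
  under the dihedral group, the ear may be assumed to sit at the last vertex, and both existence and
  uniqueness follow by induction.\<close>

text \<open>Injectivity is the cheap half: a triangulation determines its counts. The work lies in
  surjectivity and in the converse, that the counts determine the triangulation, on which the
  definite description in \<open>Psi\<close> rests. A triangulation is given here only as a maximal
  non-crossing set, with no faces and no number of diagonals at hand. So every diagonal that an
  argument has to exhibit is obtained from maximality, by checking that it crosses no member of the
  set.\<close>

lemma pair_in_polygon_sides_iff:
  assumes "x \<in> {1..n}" "y \<in> {1..n}"
  shows "{x, y} \<in> polygon_sides n \<longleftrightarrow>
    y = Suc x \<or> x = Suc y \<or> (x = 1 \<and> y = n) \<or> (x = n \<and> y = 1)"
  using assms unfolding polygon_sides_def by (auto simp: doubleton_eq_iff)

lemma crossingI: "i < j \<Longrightarrow> j < k \<Longrightarrow> k < l \<Longrightarrow> crossing {i, k} {j, l}"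
  unfolding crossing_def by blast

lemma crossing_commute: "crossing d e \<longleftrightarrow> crossing e d"
  unfolding crossing_def by blast

lemma crossingE:
  assumes "crossing d e"
  obtains i j k l where "i < j" "j < k" "k < l" "d = {i, k}" "e = {j, l}"
  | i j k l where "i < j" "j < k" "k < l" "e = {i, k}" "d = {j, l}"
  using assms unfolding crossing_def by blast

text \<open>Once the end points are ordered, the existential in \<open>crossing\<close> has only two
  possible instances, and crossing becomes linear arithmetic.\<close>

lemma crossing_pair_iff:
  assumes "i < k" "j < l"
  shows "crossing {i, k} {j, l} \<longleftrightarrow> (i < j \<and> j < k \<and> k < l) \<or> (j < i \<and> i < l \<and> l < k)"
proof
  assume "crossing {i, k} {j, l}"
  then show "(i < j \<and> j < k \<and> k < l) \<or> (j < i \<and> i < l \<and> l < k)"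
    by (cases rule: crossingE) (use assms in \<open>auto simp: doubleton_eq_iff\<close>)
next
  assume "(i < j \<and> j < k \<and> k < l) \<or> (j < i \<and> i < l \<and> l < k)"
  then show "crossing {i, k} {j, l}"
    using crossingI[of i j k l] crossingI[of j i l k] crossing_commute by blast
qed

lemma card_2_ordered:
  fixes d :: "nat set"
  assumes "card d = 2"
  obtains i k where "i < k" "d = {i, k}"
  using assms by (auto simp: card_2_iff) (metis insert_commute nat_neq_iff)

lemma polygon_diagonals_ordered:
  assumes "d \<in> polygon_diagonals n"
  obtains i k where "1 \<le> i" "Suc i < k" "k \<le> n" "d = {i, k}" "i \<noteq> 1 \<or> k \<noteq> n"
proof -
  from assms have d: "d \<subseteq> {1..n}" "card d = 2" "d \<notin> polygon_sides n"
    by (auto simp: polygon_diagonals_def)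
  from d(2) obtain i k where ik: "i < k" "d = {i, k}" by (rule card_2_ordered)
  with d pair_in_polygon_sides_iff[of i n k] that[of i k] show ?thesis by auto
qed

text \<open>Of the conditions on an ordered pair, \<open>Suc i < k\<close> excludes the sides
  between consecutive labels and the last one excludes the closing side
  \<open>{n, 1}\<close>.\<close>

lemma pair_in_polygon_diagonals_iff:
  assumes "i < k"
  shows "{i, k} \<in> polygon_diagonals n \<longleftrightarrow>
    1 \<le> i \<and> Suc i < k \<and> k \<le> n \<and> (i \<noteq> 1 \<or> k \<noteq> n)"
  using assms pair_in_polygon_sides_iff[of i n k]
  by (cases "{i, k} \<subseteq> {1..n}") (auto simp: polygon_diagonals_def)

lemma triangulations_ofD:
  assumes "D \<in> triangulations_of n"
  shows "D \<subseteq> polygon_diagonals n" "\<And>d e. d \<in> D \<Longrightarrow> e \<in> D \<Longrightarrow> \<not> crossing d e"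
    "\<And>d. d \<in> polygon_diagonals n \<Longrightarrow> (\<And>e. e \<in> D \<Longrightarrow> \<not> crossing d e) \<Longrightarrow> d \<in> D"
  using assms unfolding triangulations_of_def by blast+

lemma triangulations_ofI:
  assumes "D \<subseteq> polygon_diagonals n" "\<And>d e. d \<in> D \<Longrightarrow> e \<in> D \<Longrightarrow> \<not> crossing d e"
    "\<And>d. d \<in> polygon_diagonals n \<Longrightarrow> (\<And>e. e \<in> D \<Longrightarrow> \<not> crossing d e) \<Longrightarrow> d \<in> D"
  shows "D \<in> triangulations_of n"
  using assms unfolding triangulations_of_def by blast

lemma finite_attached: "finite (attached n D i)"
proof (rule finite_subset)
  show "attached n D i \<subseteq> Pow {1..n}" by (auto simp: attached_def triangles_def)
qed simp

subsection \<open>Dihedral symmetry\<close>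

text \<open>Diagonals, triangulations and triangles are built from cardinalities, sides and
  crossings alone, so a bijection respecting these carries everything along. Stating equivalences
  makes the notion closed under inverses.\<close>

definition polygon_symmetry :: "nat \<Rightarrow> (nat \<Rightarrow> nat) \<Rightarrow> bool" where
  "polygon_symmetry n s \<longleftrightarrow> bij_betw s {1..n} {1..n} \<and>
    (\<forall>d. d \<subseteq> {1..n} \<longrightarrow> (s ` d \<in> polygon_sides n \<longleftrightarrow> d \<in> polygon_sides n)) \<and>
    (\<forall>d e. d \<subseteq> {1..n} \<longrightarrow> e \<subseteq> {1..n} \<longrightarrow> (crossing (s ` d) (s ` e) \<longleftrightarrow> crossing d e))"

lemma polygon_symmetry_inv_into:
  assumes "polygon_symmetry n s"
  shows "polygon_symmetry n (inv_into {1..n} s)"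
proof -
  let ?t = "inv_into {1..n} s"
  have b: "bij_betw s {1..n} {1..n}" using assms by (simp add: polygon_symmetry_def)
  have t: "?t ` d \<subseteq> {1..n}" if "d \<subseteq> {1..n}" for d
    using bij_betw_inv_into[OF b] that by (auto simp: bij_betw_def)
  have st: "s ` ?t ` d = d" if "d \<subseteq> {1..n}" for d
    using b that by (simp add: bij_betw_def image_inv_into_cancel)
  show ?thesis
    unfolding polygon_symmetry_def
  proof (intro conjI allI impI)
    show "bij_betw ?t {1..n} {1..n}" by (rule bij_betw_inv_into[OF b])
  next
    fix d assume "d \<subseteq> {1..n}"
    with assms t[of d] st[of d] show "?t ` d \<in> polygon_sides n \<longleftrightarrow> d \<in> polygon_sides n"
      unfolding polygon_symmetry_def by metis
  next
    fix d e assume "d \<subseteq> {1..n}" "e \<subseteq> {1..n}"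
    with assms t[of d] st[of d] t[of e] st[of e]
    show "crossing (?t ` d) (?t ` e) \<longleftrightarrow> crossing d e"
      unfolding polygon_symmetry_def by metis
  qed
qed

lemma inv_into_image_image:
  assumes "inj_on s A" "\<And>d. d \<in> D \<Longrightarrow> d \<subseteq> A"
  shows "(`) (inv_into A s) ` (`) s ` D = D"
proof -
  have "inv_into A s ` s ` d = d" if "d \<in> D" for d
    using assms that by (simp add: inv_into_image_cancel)
  then show ?thesis by (simp add: image_image)
qed

lemma polygon_symmetry_triangulations_of:
  assumes s: "polygon_symmetry n s" and D: "D \<in> triangulations_of n"
  shows "(`) s ` D \<in> triangulations_of n"
proof -
  have b: "bij_betw s {1..n} {1..n}"
    and side: "\<And>d. d \<subseteq> {1..n} \<Longrightarrow> s ` d \<in> polygon_sides n \<longleftrightarrow> d \<in> polygon_sides n"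
    and cross: "\<And>d e. d \<subseteq> {1..n} \<Longrightarrow> e \<subseteq> {1..n} \<Longrightarrow> crossing (s ` d) (s ` e) \<longleftrightarrow> crossing d e"
    using s by (simp_all add: polygon_symmetry_def)
  have inj: "inj_on s d" if "d \<subseteq> {1..n}" for d
    using b that by (meson bij_betw_def inj_on_subset)
  have diag: "s ` d \<in> polygon_diagonals n \<longleftrightarrow> d \<in> polygon_diagonals n" if "d \<subseteq> {1..n}" for d
  proof -
    have "s ` d \<subseteq> {1..n}" using b that by (auto simp: bij_betw_def)
    then show ?thesis
      using that side[OF that] by (simp add: polygon_diagonals_def card_image inj)
  qed
  note D1 = triangulations_ofD[OF D]
  have sub: "d \<subseteq> {1..n}" if "d \<in> polygon_diagonals n" for d
    using that by (simp add: polygon_diagonals_def)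
  show ?thesis
  proof (rule triangulations_ofI)
    show "(`) s ` D \<subseteq> polygon_diagonals n" using D1(1) diag sub by blast
  next
    fix d e assume "d \<in> (`) s ` D" "e \<in> (`) s ` D"
    then show "\<not> crossing d e" using D1(1,2) cross sub by blast
  next
    fix d assume d: "d \<in> polygon_diagonals n" and nc: "\<And>e. e \<in> (`) s ` D \<Longrightarrow> \<not> crossing d e"
    \<comment> \<open>Maximality is known for \<open>D\<close> and not for its image, so the
      candidate is pulled back along \<open>s\<close> first.\<close>
    have "d \<subseteq> s ` {1..n}" using sub[OF d] b by (simp add: bij_betw_def)
    then obtain d' where d': "d' \<subseteq> {1..n}" "d = s ` d'" by (auto simp: subset_image_iff)
    have "d' \<in> D"
    proof (rule D1(3))
      show "d' \<in> polygon_diagonals n" using d d' diag by simp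
    next
      fix e assume e: "e \<in> D"
      with nc[of "s ` e"] cross[of d' e] d' sub D1(1) show "\<not> crossing d' e" by blast
    qed
    then show "d \<in> (`) s ` D" using d' by blast
  qed
qed

text \<open>Taking images under \<open>s\<close> injects the triangles at \<open>i\<close> into
  those at \<open>s i\<close>. An inequality for arbitrary \<open>D\<close> suffices, because it can
  be applied to the inverse symmetry as well.\<close>

lemma polygon_symmetry_card_attached_le:
  assumes s: "polygon_symmetry n s" and i: "i \<in> {1..n}"
  shows "card (attached n D i) \<le> card (attached n ((`) s ` D) (s i))"
proof (rule card_inj_on_le[where f = "(`) s"])
  have b: "bij_betw s {1..n} {1..n}"
    and side: "\<And>d. d \<subseteq> {1..n} \<Longrightarrow> s ` d \<in> polygon_sides n \<longleftrightarrow> d \<in> polygon_sides n"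
    using s by (simp_all add: polygon_symmetry_def)
  have inj: "inj_on s d" if "d \<subseteq> {1..n}" for d
    using b that by (meson bij_betw_def inj_on_subset)
  show "inj_on ((`) s) (attached n D i)"
    by (rule inj_onI)
      (use b in \<open>auto simp: attached_def triangles_def bij_betw_def inj_on_image_eq_iff\<close>)
  show "(`) s ` attached n D i \<subseteq> attached n ((`) s ` D) (s i)"
  proof
    fix u assume "u \<in> (`) s ` attached n D i"
    then obtain t where t: "u = s ` t" "i \<in> t" "t \<subseteq> {1..n}" "card t = 3"
      and edge: "\<And>e. e \<subseteq> t \<Longrightarrow> card e = 2 \<Longrightarrow> e \<in> polygon_sides n \<union> D"
      by (auto simp: attached_def triangles_def)
    have "e \<in> polygon_sides n \<union> (`) s ` D" if e: "e \<subseteq> s ` t" "card e = 2" for e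
    proof -
      from e obtain e' where e': "e' \<subseteq> t" "e = s ` e'" by (auto simp: subset_image_iff)
      have sub: "e' \<subseteq> {1..n}" using e' t by blast
      have "card e' = 2" using e e' card_image[OF inj[OF sub]] by simp
      then have "e' \<in> polygon_sides n \<union> D" using edge e' by blast
      then show ?thesis using side[OF sub] e' by blast
    qed
    moreover have "u \<subseteq> {1..n}" using t b by (auto simp: bij_betw_def)
    moreover have "card u = 3" using t inj card_image by metis
    ultimately show "u \<in> attached n ((`) s ` D) (s i)"
      using t by (auto simp: attached_def triangles_def)
  qed
qed (rule finite_attached)

text \<open>The reverse inequality is the previous bound for the inverse of \<open>s\<close> and the
  image of \<open>D\<close>. The members of \<open>D\<close> must lie in \<open>{1..n}\<close>,
  where that inverse really undoes \<open>s\<close>.\<close>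

lemma polygon_symmetry_card_attached:
  assumes s: "polygon_symmetry n s" and i: "i \<in> {1..n}" and D: "\<And>d. d \<in> D \<Longrightarrow> d \<subseteq> {1..n}"
  shows "card (attached n ((`) s ` D) (s i)) = card (attached n D i)"
proof (rule antisym)
  have b: "bij_betw s {1..n} {1..n}" using s by (simp add: polygon_symmetry_def)
  then have "s i \<in> {1..n}" "inv_into {1..n} s (s i) = i"
    using i by (auto simp: bij_betw_def)
  moreover have "(`) (inv_into {1..n} s) ` (`) s ` D = D"
    using b D by (intro inv_into_image_image) (auto simp: bij_betw_def)
  ultimately show "card (attached n ((`) s ` D) (s i)) \<le> card (attached n D i)"
    using polygon_symmetry_card_attached_le[OF polygon_symmetry_inv_into[OF s], of "s i" "(`) s ` D"]
    by simp
qed (rule polygon_symmetry_card_attached_le[OF s i])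

lemma realizes_triangulations_of: "realizes D c \<Longrightarrow> D \<in> triangulations_of (length c)"
  by (simp add: realizes_def)

lemma triangulations_of_subset_vertices:
  "D \<in> triangulations_of n \<Longrightarrow> d \<in> D \<Longrightarrow> d \<subseteq> {1..n}"
  using triangulations_ofD(1) unfolding polygon_diagonals_def by blast

lemma polygon_symmetry_realizes:
  assumes s: "polygon_symmetry (length c) s" and D: "realizes D c"
    and len: "length c' = length c"
    and c': "\<And>i. i \<in> {1..length c} \<Longrightarrow> c' ! (s i - 1) = c ! (i - 1)"
  shows "realizes ((`) s ` D) c'"
  unfolding realizes_def
proof (intro conjI ballI)
  show "(`) s ` D \<in> triangulations_of (length c')"
    using polygon_symmetry_triangulations_of[OF s realizes_triangulations_of[OF D]] len by simp
next
  fix j assume "j \<in> {1..length c'}"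
  with s len have "j \<in> s ` {1..length c}" by (simp add: polygon_symmetry_def bij_betw_def)
  then obtain i where i: "i \<in> {1..length c}" "j = s i" by blast
  have "card (attached (length c) ((`) s ` D) (s i)) = card (attached (length c) D i)"
    using polygon_symmetry_card_attached[OF s i(1)]
      triangulations_of_subset_vertices[OF realizes_triangulations_of[OF D]] by blast
  then show "card (attached (length c') ((`) s ` D) j) = c' ! (j - 1)"
    using D c'[OF i(1)] i len by (simp add: realizes_def)
qed

text \<open>Uniqueness travels backwards: a realization of \<open>c'\<close> is moved by the inverse
  symmetry to one of \<open>c\<close>, which must be \<open>D\<close>, and is recovered by applying
  \<open>s\<close> again.\<close>

lemma polygon_symmetry_ex1_realizes:
  assumes s: "polygon_symmetry (length c) s" and ex1: "\<exists>!D. realizes D c"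
    and len: "length c' = length c"
    and c': "\<And>i. i \<in> {1..length c} \<Longrightarrow> c' ! (s i - 1) = c ! (i - 1)"
  shows "\<exists>!D. realizes D c'"
proof -
  let ?n = "length c" let ?t = "inv_into {1..?n} s"
  have b: "bij_betw s {1..?n} {1..?n}" using s by (simp add: polygon_symmetry_def)
  have t: "polygon_symmetry (length c') ?t"
    using polygon_symmetry_inv_into[OF s] len by simp
  have c: "c ! (?t i - 1) = c' ! (i - 1)" if "i \<in> {1..length c'}" for i
  proof -
    have "i \<in> s ` {1..?n}" using b len that by (simp add: bij_betw_def)
    then show ?thesis
      using c'[of "?t i"] by (metis f_inv_into_f inv_into_into)
  qed
  obtain D where D: "realizes D c" and uniq: "\<And>E. realizes E c \<Longrightarrow> E = D" using ex1 by blast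
  show ?thesis
  proof (rule ex1I)
    show "realizes ((`) s ` D) c'" by (rule polygon_symmetry_realizes[OF s D len c'])
  next
    fix E assume E: "realizes E c'"
    have "(`) ?t ` E = D"
      by (rule uniq, rule polygon_symmetry_realizes[OF t E len[symmetric] c])
    moreover have "(`) s ` (`) ?t ` E = E"
    proof -
      have "s ` ?t ` d = d" if "d \<in> E" for d
        using triangulations_of_subset_vertices[OF realizes_triangulations_of[OF E] that] b len
        by (simp add: bij_betw_def image_inv_into_cancel)
      then show ?thesis by (simp add: image_image)
    qed
    ultimately show "E = (`) s ` D" by simp
  qed
qed

text \<open>Sides and crossing sets have at most two elements, so it is enough to test pairs of
  vertices; for all other sets both sides of each equivalence are false, since \<open>s\<close>
  preserves cardinality.\<close>

lemma polygon_symmetryI: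
  assumes b: "bij_betw s {1..n} {1..n}"
    and s: "\<And>i j. i \<in> {1..n} \<Longrightarrow> j \<in> {1..n} \<Longrightarrow>
      {s i, s j} \<in> polygon_sides n \<longleftrightarrow> {i, j} \<in> polygon_sides n"
    and c: "\<And>i j k l. i \<in> {1..n} \<Longrightarrow> j \<in> {1..n} \<Longrightarrow> k \<in> {1..n} \<Longrightarrow> l \<in> {1..n} \<Longrightarrow>
      crossing {s i, s k} {s j, s l} \<longleftrightarrow> crossing {i, k} {j, l}"
  shows "polygon_symmetry n s"
proof -
  have card: "card (s ` d) = card d" if "d \<subseteq> {1..n}" for d
    using b that by (meson bij_betw_def card_image inj_on_subset)
  have pair: "\<exists>i k. d = {i, k} \<and> i \<in> {1..n} \<and> k \<in> {1..n}" if "d \<subseteq> {1..n}" "card d \<in> {1, 2}" for d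
  proof -
    from that(2) obtain i k where "d = {i, k}" by (auto simp: card_2_iff card_1_singleton_iff)
    with that(1) show ?thesis by blast
  qed
  \<comment> \<open>Cardinality 1 occurs only for \<open>n = 1\<close>, where the closing side
    \<open>{n, 1}\<close> degenerates to a point.\<close>
  have side: "card d \<in> {1, 2}" if "d \<in> polygon_sides n" for d
    using that by (cases "n = 1") (auto simp: polygon_sides_def card_insert_if)
  have cross: "card d \<in> {1, 2} \<and> card e \<in> {1, 2}" if "crossing d e" for d e
    using that by (cases rule: crossingE) auto
  show ?thesis
    unfolding polygon_symmetry_def
  proof (intro conjI allI impI)
    fix d assume d: "d \<subseteq> {1..n}"
    show "s ` d \<in> polygon_sides n \<longleftrightarrow> d \<in> polygon_sides n"
    proof (cases "card d \<in> {1, 2}")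
      case True
      then obtain i k where "d = {i, k}" "i \<in> {1..n}" "k \<in> {1..n}" using pair[OF d] by blast
      then show ?thesis using s[of i k] by simp
    next
      case False
      then show ?thesis using side[of d] side[of "s ` d"] card[OF d] by auto
    qed
  next
    fix d e assume d: "d \<subseteq> {1..n}" and e: "e \<subseteq> {1..n}"
    show "crossing (s ` d) (s ` e) \<longleftrightarrow> crossing d e"
    proof (cases "card d \<in> {1, 2} \<and> card e \<in> {1, 2}")
      case True
      then obtain i k j l where "d = {i, k}" "i \<in> {1..n}" "k \<in> {1..n}"
        "e = {j, l}" "j \<in> {1..n}" "l \<in> {1..n}" using pair[OF d] pair[OF e] by metis
      then show ?thesis using c[of i j k l] by simp
    next
      case False
      then show ?thesis using cross[of d e] cross[of "s ` d" "s ` e"] card[OF d] card[OF e] by metis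
    qed
  qed (rule b)
qed

section \<open>Rotation and reflection of the polygon\<close>

definition between :: "nat \<Rightarrow> nat \<Rightarrow> nat \<Rightarrow> bool" where
  "between i k j \<longleftrightarrow> (i < j \<and> j < k) \<or> (k < j \<and> j < i)"

text \<open>Unlike the definition, this form needs no order on the end points. A rotation that moves an
  end point across the labels \<open>1\<close> and \<open>n\<close> negates both occurrences of \<open>between\<close>.\<close>

lemma crossing_iff_between:
  "crossing {i, k} {j, l} \<longleftrightarrow>
    i \<noteq> j \<and> i \<noteq> l \<and> k \<noteq> j \<and> k \<noteq> l \<and> between i k j \<noteq> between i k l"
proof
  assume "crossing {i, k} {j, l}"
  then show "i \<noteq> j \<and> i \<noteq> l \<and> k \<noteq> j \<and> k \<noteq> l \<and> between i k j \<noteq> between i k l"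
    by (cases rule: crossingE) (auto simp: doubleton_eq_iff between_def)
next
  assume r: "i \<noteq> j \<and> i \<noteq> l \<and> k \<noteq> j \<and> k \<noteq> l \<and> between i k j \<noteq> between i k l"
  have *: "crossing {a, b} {x, y}"
    if "a \<noteq> x \<and> a \<noteq> y \<and> b \<noteq> x \<and> b \<noteq> y \<and> between a b x \<noteq> between a b y" "a < b" "x < y" for a b x y
    using that by (subst crossing_pair_iff) (auto simp: between_def)
  have **: "crossing {a, b} {x, y}"
    if "a \<noteq> x \<and> a \<noteq> y \<and> b \<noteq> x \<and> b \<noteq> y \<and> between a b x \<noteq> between a b y" "a < b" for a b x y
    using that *[of a x y b] *[of a y x b]
    by (cases x y rule: linorder_cases) (auto simp: insert_commute)
  show "crossing {i, k} {j, l}"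
  proof (cases i k rule: linorder_cases)
    case less
    with r show ?thesis by (rule **)
  next
    case equal
    with r show ?thesis by (auto simp: between_def)
  next
    case greater
    from r have "k \<noteq> j \<and> k \<noteq> l \<and> i \<noteq> j \<and> i \<noteq> l \<and> between k i j \<noteq> between k i l"
      unfolding between_def by blast
    from **[OF this greater] show ?thesis by (simp add: insert_commute)
  qed
qed

lemma crossing_distinct:
  "crossing {i, k} {j, l} \<Longrightarrow> i \<noteq> k \<and> i \<noteq> j \<and> i \<noteq> l \<and> k \<noteq> j \<and> k \<noteq> l"
  unfolding crossing_iff_between between_def by auto

text \<open>The direction is that of \<open>rotate1\<close>: the head of the list, at vertex 1,
  moves to the end, and all other entries move down by one.\<close>

definition rotate_vertex :: "nat \<Rightarrow> nat \<Rightarrow> nat" where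
  "rotate_vertex n i = (if i = 1 then n else i - 1)"

lemma polygon_symmetry_rotate_vertex: "polygon_symmetry n (rotate_vertex n)"
proof (rule polygon_symmetryI)
  show "bij_betw (rotate_vertex n) {1..n} {1..n}"
    by (rule bij_betw_byWitness[where f' = "\<lambda>i. if i = n then 1 else i + 1"])
      (auto simp: rotate_vertex_def)
next
  fix i j assume "i \<in> {1..n}" "j \<in> {1..n}"
  moreover from this have "rotate_vertex n i \<in> {1..n}" "rotate_vertex n j \<in> {1..n}"
    by (auto simp: rotate_vertex_def)
  ultimately show "{rotate_vertex n i, rotate_vertex n j} \<in> polygon_sides n \<longleftrightarrow>
      {i, j} \<in> polygon_sides n"
    by (simp only: pair_in_polygon_sides_iff) (auto simp: rotate_vertex_def)
next
  \<comment> \<open>If \<open>i\<close> or \<open>k\<close> is 1, that end point jumps from the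
    bottom of the order to the top, which complements the open interval. If \<open>j\<close> is 1,
    it lies below the pair before the rotation and above it afterwards, so outside both
    times.\<close>
  have btw: "between (rotate_vertex n i) (rotate_vertex n k) (rotate_vertex n j) \<longleftrightarrow>
      between i k j \<noteq> (i = 1 \<or> k = 1)"
    if "i \<in> {1..n}" "k \<in> {1..n}" "j \<in> {1..n}" "i \<noteq> j" "k \<noteq> j" "i \<noteq> k" for i k j
    using that unfolding between_def rotate_vertex_def by auto
  have eq: "rotate_vertex n i = rotate_vertex n j \<longleftrightarrow> i = j"
    if "i \<in> {1..n}" "j \<in> {1..n}" for i j
    using that unfolding rotate_vertex_def by auto
  fix i j k l assume v: "i \<in> {1..n}" "j \<in> {1..n}" "k \<in> {1..n}" "l \<in> {1..n}"
  show "crossing {rotate_vertex n i, rotate_vertex n k} {rotate_vertex n j, rotate_vertex n l} \<longleftrightarrow>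
      crossing {i, k} {j, l}"
  proof (cases "i \<noteq> k \<and> i \<noteq> j \<and> i \<noteq> l \<and> k \<noteq> j \<and> k \<noteq> l")
    case True
    then have "rotate_vertex n i \<noteq> rotate_vertex n j" "rotate_vertex n i \<noteq> rotate_vertex n l"
      "rotate_vertex n k \<noteq> rotate_vertex n j" "rotate_vertex n k \<noteq> rotate_vertex n l"
      using eq v by blast+
    moreover have "between (rotate_vertex n i) (rotate_vertex n k) (rotate_vertex n j) \<longleftrightarrow>
        between i k j \<noteq> (i = 1 \<or> k = 1)"
      "between (rotate_vertex n i) (rotate_vertex n k) (rotate_vertex n l) \<longleftrightarrow>
        between i k l \<noteq> (i = 1 \<or> k = 1)"
      using True v by (simp_all only: btw not_False_eq_True)
    ultimately show ?thesis using True unfolding crossing_iff_between by blast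
  next
    case False
    then show ?thesis using crossing_distinct by blast
  qed
qed

definition reflect_vertex :: "nat \<Rightarrow> nat \<Rightarrow> nat" where
  "reflect_vertex n i = Suc n - i"

text \<open>Reversing the order of the labels exchanges the two disjuncts of \<open>between\<close>,
  which is therefore preserved outright.\<close>

lemma polygon_symmetry_reflect_vertex: "polygon_symmetry n (reflect_vertex n)"
proof (rule polygon_symmetryI)
  show "bij_betw (reflect_vertex n) {1..n} {1..n}"
    by (rule bij_betw_byWitness[where f' = "reflect_vertex n"]) (auto simp: reflect_vertex_def)
next
  fix i j assume "i \<in> {1..n}" "j \<in> {1..n}"
  moreover from this have "reflect_vertex n i \<in> {1..n}" "reflect_vertex n j \<in> {1..n}"
    by (auto simp: reflect_vertex_def)
  ultimately show "{reflect_vertex n i, reflect_vertex n j} \<in> polygon_sides n \<longleftrightarrow>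
      {i, j} \<in> polygon_sides n"
    by (simp only: pair_in_polygon_sides_iff) (auto simp: reflect_vertex_def)
next
  have btw: "between (reflect_vertex n i) (reflect_vertex n k) (reflect_vertex n j) \<longleftrightarrow> between i k j"
    if "i \<in> {1..n}" "k \<in> {1..n}" "j \<in> {1..n}" for i k j
    using that unfolding between_def reflect_vertex_def by auto
  have eq: "reflect_vertex n i = reflect_vertex n j \<longleftrightarrow> i = j"
    if "i \<in> {1..n}" "j \<in> {1..n}" for i j
    using that unfolding reflect_vertex_def by auto
  fix i j k l assume "i \<in> {1..n}" "j \<in> {1..n}" "k \<in> {1..n}" "l \<in> {1..n}"
  then show "crossing {reflect_vertex n i, reflect_vertex n k} {reflect_vertex n j, reflect_vertex n l} \<longleftrightarrow>
      crossing {i, k} {j, l}"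
    by (simp only: crossing_iff_between btw eq)
qed

subsection \<open>Ears\<close>

text \<open>An ear is attached at the side between the first and the last vertex, so that the old
  vertices keep their labels.\<close>

lemma polygon_diagonals_Suc_iff:
  assumes "n \<ge> 3" "Suc n \<notin> d"
  shows "d \<in> polygon_diagonals (Suc n) \<longleftrightarrow> d = {1, n} \<or> d \<in> polygon_diagonals n"
proof (cases "\<exists>i k. i < k \<and> d = {i, k}")
  case True
  then obtain i k where "i < k" "d = {i, k}" by blast
  with assms show ?thesis by (auto simp: pair_in_polygon_diagonals_iff doubleton_eq_iff)
next
  case False
  have "\<not> (\<exists>m. d \<in> polygon_diagonals m)"
  proof
    assume "\<exists>m. d \<in> polygon_diagonals m"
    then show False using False by (meson polygon_diagonals_ordered Suc_lessD)
  qed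
  moreover have "d \<noteq> {1, n}" using False assms by auto
  ultimately show ?thesis by blast
qed

text \<open>A crossing partner of \<open>{1, n}\<close> would need an end point below 1 or above
  \<open>n\<close>.\<close>

lemma not_crossing_ear:
  assumes "n \<ge> 1" "e \<subseteq> {1..n}"
  shows "\<not> crossing {1, n} e"
proof
  assume "crossing {1, n} e"
  then show False
    by (cases rule: crossingE) (use assms in \<open>auto simp: doubleton_eq_iff\<close>)
qed

text \<open>Maximality survives because a diagonal at the new vertex \<open>Suc n\<close> has its
  other end strictly between 1 and \<open>n\<close> and so crosses \<open>{1, n}\<close>, while
  every other diagonal is \<open>{1, n}\<close> or one of the old polygon.\<close>

lemma triangulations_of_attach_ear:
  assumes n: "n \<ge> 3" and D: "D \<in> triangulations_of n"
  shows "insert {1, n} D \<in> triangulations_of (Suc n)"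
proof (rule triangulations_ofI)
  have sub: "d \<subseteq> {1..n}" "Suc n \<notin> d" if "d \<in> D" for d
    using triangulations_of_subset_vertices[OF D that] by auto
  have ear: "Suc n \<notin> {1, n}" using n by simp
  show "insert {1, n} D \<subseteq> polygon_diagonals (Suc n)"
  proof
    fix d assume "d \<in> insert {1, n} D"
    then have "Suc n \<notin> d" "d = {1, n} \<or> d \<in> polygon_diagonals n"
      using ear sub(2) triangulations_ofD(1)[OF D] by auto
    then show "d \<in> polygon_diagonals (Suc n)" using polygon_diagonals_Suc_iff[OF n] by simp
  qed
  show "\<not> crossing d e" if d: "d \<in> insert {1, n} D" and e: "e \<in> insert {1, n} D" for d e
  proof -
    have n1: "n \<ge> 1" using n by simp
    have de: "d \<subseteq> {1..n}" "e \<subseteq> {1..n}" using d e sub(1) n by auto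
    consider "d = {1, n}" | "e = {1, n}" | "d \<in> D" "e \<in> D" using d e by blast
    then show ?thesis
    proof cases
      case 1
      then show ?thesis using not_crossing_ear[OF n1 de(2)] by simp
    next
      case 2
      then show ?thesis using not_crossing_ear[OF n1 de(1)] by (simp add: crossing_commute[of d])
    next
      case 3
      then show ?thesis by (rule triangulations_ofD(2)[OF D])
    qed
  qed
  show "d \<in> insert {1, n} D"
    if d: "d \<in> polygon_diagonals (Suc n)"
      and nc: "\<And>e. e \<in> insert {1, n} D \<Longrightarrow> \<not> crossing d e" for d
  proof (cases "Suc n \<in> d")
    case True
    from d obtain i k where ik: "1 \<le> i" "Suc i < k" "k \<le> Suc n" "d = {i, k}" "i \<noteq> 1 \<or> k \<noteq> Suc n"
      by (rule polygon_diagonals_ordered)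
    with True have "1 < i" "i < n" "k = Suc n" by auto
    then have "crossing d {1, n}"
      using ik crossingI[of 1 i n "Suc n"] crossing_commute by blast
    then show ?thesis using nc by blast
  next
    case False
    then have "d = {1, n} \<or> d \<in> polygon_diagonals n"
      using d polygon_diagonals_Suc_iff[OF n] by blast
    then show ?thesis using nc triangulations_ofD(3)[OF D, of d] by blast
  qed
qed

text \<open>With no diagonal at \<open>Suc n\<close>, all members of \<open>E\<close> live on
  \<open>{1..n}\<close> and none can cross \<open>{1, n}\<close>. Maximality of \<open>E\<close>
  then forces \<open>{1, n}\<close> into it, and deleting it leaves the smaller
  triangulation.\<close>

lemma triangulations_of_remove_ear:
  assumes n: "n \<ge> 3" and E: "E \<in> triangulations_of (Suc n)"
    and ear: "\<And>d. d \<in> E \<Longrightarrow> Suc n \<notin> d"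
  obtains D where "D \<in> triangulations_of n" "E = insert {1, n} D"
proof -
  have ear_diag: "{1, n} \<in> polygon_diagonals (Suc n)"
    using n polygon_diagonals_Suc_iff[of n "{1, n}"] by simp
  have sub: "e \<subseteq> {1..n}" if "e \<in> E" for e
    using triangulations_of_subset_vertices[OF E that] ear[OF that]
    by (auto simp: le_Suc_eq subset_iff)
  have n1: "n \<ge> 1" using n by simp
  have "{1, n} \<in> E"
    by (rule triangulations_ofD(3)[OF E ear_diag]) (rule not_crossing_ear[OF n1 sub])
  moreover have "E - {{1, n}} \<in> triangulations_of n"
  proof (rule triangulations_ofI)
    show "E - {{1, n}} \<subseteq> polygon_diagonals n"
      using triangulations_ofD(1)[OF E] ear polygon_diagonals_Suc_iff[OF n] by blast
    show "\<not> crossing d e" if "d \<in> E - {{1, n}}" "e \<in> E - {{1, n}}" for d e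
      using that triangulations_ofD(2)[OF E] by blast
    show "d \<in> E - {{1, n}}"
      if d: "d \<in> polygon_diagonals n" and nc: "\<And>e. e \<in> E - {{1, n}} \<Longrightarrow> \<not> crossing d e" for d
    proof -
      \<comment> \<open>In the \<open>n\<close>-gon \<open>{1, n}\<close> is the closing side, hence
        not a diagonal.\<close>
      have dsub: "d \<subseteq> {1..n}" and "d \<noteq> {1, n}"
        using d by (auto simp: polygon_diagonals_def polygon_sides_def insert_commute)
      have "d \<in> E"
      proof (rule triangulations_ofD(3)[OF E])
        have "Suc n \<notin> d" using dsub by auto
        then show "d \<in> polygon_diagonals (Suc n)" using d polygon_diagonals_Suc_iff[OF n] by blast
        show "\<not> crossing d e" if "e \<in> E" for e
          using nc that not_crossing_ear[OF n1 dsub] crossing_commute by blast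
      qed
      then show ?thesis using \<open>d \<noteq> {1, n}\<close> by blast
    qed
  qed
  ultimately show ?thesis using that[of "E - {{1, n}}"] by blast
qed

section \<open>Triangle counts after attaching an ear\<close>

lemma triangles_attach_ear:
  assumes n: "n \<ge> 3" and D: "\<And>d. d \<in> D \<Longrightarrow> d \<subseteq> {1..n}"
  shows "triangles (Suc n) (insert {1, n} D) = insert {1, n, Suc n} (triangles n D)"
proof -
  \<comment> \<open>The edge \<open>{1, n}\<close> only changes its status from closing side to
    diagonal; the genuinely new edges are the two at \<open>Suc n\<close>.\<close>
  have edges: "e \<in> polygon_sides (Suc n) \<union> insert {1, n} D \<longleftrightarrow>
      e \<in> polygon_sides n \<union> D \<or> e = {n, Suc n} \<or> e = {1, Suc n}" for e
    using n by (auto simp: polygon_sides_def insert_commute less_Suc_eq)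
  have old: "e \<subseteq> {1..n}" if "e \<in> polygon_sides n \<union> D" for e
    using that D n by (auto simp: polygon_sides_def)
  \<comment> \<open>The new vertex has just the neighbours 1 and \<open>n\<close>, which leaves room
    for a single triangle there.\<close>
  have new: "x = 1 \<or> x = n" if "{x, Suc n} \<in> polygon_sides (Suc n) \<union> insert {1, n} D" "x \<noteq> Suc n" for x
    using that old[of "{x, Suc n}"] unfolding edges by (auto simp: doubleton_eq_iff)
  show ?thesis
  proof (intro equalityI subsetI)
    fix t assume "t \<in> triangles (Suc n) (insert {1, n} D)"
    then have t: "t \<subseteq> {1..Suc n}" "card t = 3"
      and e: "\<And>e. e \<subseteq> t \<Longrightarrow> card e = 2 \<Longrightarrow> e \<in> polygon_sides (Suc n) \<union> insert {1, n} D"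
      unfolding triangles_def by blast+
    show "t \<in> insert {1, n, Suc n} (triangles n D)"
    proof (cases "Suc n \<in> t")
      case True
      have "x \<in> {1, n, Suc n}" if "x \<in> t" for x
        using e[of "{x, Suc n}"] that True new[of x] by (cases "x = Suc n") auto
      then have "t \<subseteq> {1, n, Suc n}" by blast
      then have "t = {1, n, Suc n}" by (rule card_subset_eq[rotated]) (use n t in auto)
      then show ?thesis by blast
    next
      case False
      then have "t \<subseteq> {1..n}" using t(1) by (auto simp: le_Suc_eq subset_iff)
      moreover have "e \<in> polygon_sides n \<union> D" if "e \<subseteq> t" "card e = 2" for e
        using e[OF that] that(1) False unfolding edges by blast
      ultimately show ?thesis using t(2) unfolding triangles_def by blast
    qed
  next
    fix t assume "t \<in> insert {1, n, Suc n} (triangles n D)"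
    then consider "t = {1, n, Suc n}" | "t \<in> triangles n D" by blast
    then show "t \<in> triangles (Suc n) (insert {1, n} D)"
    proof cases
      case 1
      have "e \<in> {{1, n}, {n, Suc n}, {1, Suc n}}" if "e \<subseteq> t" "card e = 2" for e
        using that unfolding 1 card_2_iff by (auto simp: doubleton_eq_iff)
      then have "e \<in> polygon_sides (Suc n) \<union> insert {1, n} D" if "e \<subseteq> t" "card e = 2" for e
        using that unfolding edges by (auto simp: polygon_sides_def)
      moreover have "t \<subseteq> {1..Suc n}" "card t = 3" using n unfolding 1 by auto
      ultimately show ?thesis unfolding triangles_def by blast
    next
      case 2
      then have "t \<subseteq> {1..Suc n}" by (auto simp: triangles_def)
      with 2 show ?thesis unfolding triangles_def using edges by blast
    qed
  qed
qed

lemma card_attached_attach_ear: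
  assumes n: "n \<ge> 3" and D: "\<And>d. d \<in> D \<Longrightarrow> d \<subseteq> {1..n}"
  shows "card (attached (Suc n) (insert {1, n} D) i) =
    card (attached n D i) + (if i \<in> {1, n, Suc n} then 1 else 0)"
proof -
  have "{1, n, Suc n} \<notin> attached n D i" by (auto simp: attached_def triangles_def)
  moreover have "attached (Suc n) (insert {1, n} D) i =
      (if i \<in> {1, n, Suc n} then insert {1, n, Suc n} (attached n D i) else attached n D i)"
    using triangles_attach_ear[OF n D] unfolding attached_def by auto
  ultimately show ?thesis by (simp add: finite_attached)
qed

lemma attached_outside: "i \<notin> {1..n} \<Longrightarrow> attached n D i = {}"
  by (auto simp: attached_def triangles_def)

text \<open>The longer list is the result of \<open>insert_one\<close> on \<open>a # b # c\<close>,
  rotated twice so that the inserted 1 comes last. Its cyclic neighbours are then the first and the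
  last old vertex, with the old entries \<open>b\<close> and \<open>a\<close>.\<close>

lemma realizes_attach_ear_iff:
  assumes n: "length c \<ge> 1" and D: "D \<in> triangulations_of (Suc (Suc (length c)))"
  shows "realizes (insert {1, Suc (Suc (length c))} D) (Suc b # c @ [Suc a, 1]) \<longleftrightarrow>
    realizes D (b # c @ [a])"
proof -
  let ?n = "Suc (Suc (length c))"
  let ?E = "insert {1, ?n} D"
  have n3: "?n \<ge> 3" using n by simp
  have E: "?E \<in> triangulations_of (Suc ?n)" by (rule triangulations_of_attach_ear[OF n3 D])
  have att: "card (attached (Suc ?n) ?E i) =
      card (attached ?n D i) + (if i \<in> {1, ?n, Suc ?n} then 1 else 0)" for i
    by (rule card_attached_attach_ear[OF n3 triangulations_of_subset_vertices[OF D]])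
  have last: "card (attached (Suc ?n) ?E (Suc ?n)) = 1"
    unfolding att by (simp add: attached_outside)
  have vertices: "{1..Suc ?n} = insert (Suc ?n) {1..?n}" by auto
  have entry: "card (attached (Suc ?n) ?E i) = (Suc b # c @ [Suc a, 1]) ! (i - 1) \<longleftrightarrow>
      card (attached ?n D i) = (b # c @ [a]) ! (i - 1)" if "i \<in> {1..?n}" for i
    using that n unfolding att by (auto simp: nth_Cons nth_append split: nat.split)
  have "realizes ?E (Suc b # c @ [Suc a, 1]) \<longleftrightarrow>
      (\<forall>i\<in>{1..Suc ?n}. card (attached (Suc ?n) ?E i) = (Suc b # c @ [Suc a, 1]) ! (i - 1))"
    using E by (simp add: realizes_def)
  also have "\<dots> \<longleftrightarrow> (\<forall>i\<in>{1..?n}. card (attached ?n D i) = (b # c @ [a]) ! (i - 1))"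
    unfolding vertices using last entry by (simp add: nth_append)
  also have "\<dots> \<longleftrightarrow> realizes D (b # c @ [a])"
    using D by (simp add: realizes_def)
  finally show ?thesis .
qed

text \<open>Let \<open>{p, n}\<close> and \<open>{q, n}\<close> be the diagonals at \<open>n\<close> with the smallest and the largest other end
  point. By maximality \<open>{1, p, n}\<close> and \<open>{q, n - 1, n}\<close> are triangles, and they are distinct.\<close>

lemma card_attached_last_ge_2:
  assumes E: "E \<in> triangulations_of n" and d: "d \<in> E" "n \<in> d"
  shows "card (attached n E n) \<ge> 2"
proof -
  define J where "J = {j. {j, n} \<in> E \<and> j < n}"
  have J: "1 < x" "Suc x < n" "{x, n} \<in> E" if "x \<in> J" for x
    using that pair_in_polygon_diagonals_iff[of x n n] triangulations_ofD(1)[OF E]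
    by (auto simp: J_def)
  have fin: "finite J" unfolding J_def by auto
  have "J \<noteq> {}"
  proof -
    from d triangulations_ofD(1)[OF E] have "d \<in> polygon_diagonals n" by blast
    then obtain i k where "1 \<le> i" "Suc i < k" "k \<le> n" "d = {i, k}" by (rule polygon_diagonals_ordered)
    with d show ?thesis by (auto simp: J_def)
  qed
  define p q where "p = Min J" and "q = Max J"
  have p: "p \<in> J" and q: "q \<in> J" using fin \<open>J \<noteq> {}\<close> by (simp_all add: p_def q_def)
  have p_min: "p \<le> x" and q_max: "x \<le> q" if "x \<in> J" for x
    using that fin by (simp_all add: p_def q_def)
  note pJ = J[OF p] and qJ = J[OF q]
  have ordered: "\<exists>a b. 1 \<le> a \<and> a < b \<and> b \<le> n \<and> e = {a, b}" if "e \<in> E" for e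
    using that triangulations_ofD(1)[OF E] by (meson polygon_diagonals_ordered Suc_lessD subsetD)
  have p1: "{1, p} \<in> polygon_sides n \<union> E"
  proof (cases "p = 2")
    case True
    then show ?thesis using pJ pair_in_polygon_sides_iff[of 1 n 2] by simp
  next
    case False
    \<comment> \<open>A diagonal crossing \<open>{1, p}\<close> has one end \<open>a\<close>
      strictly between 1 and \<open>p\<close> and the other beyond \<open>p\<close>. If the other
      end is \<open>n\<close>, then \<open>a\<close> contradicts minimality of \<open>p\<close>;
      otherwise the diagonal crosses \<open>{p, n}\<close>.\<close>
    have "{1, p} \<in> E"
    proof (rule triangulations_ofD(3)[OF E])
      show "{1, p} \<in> polygon_diagonals n"
        using pJ False by (subst pair_in_polygon_diagonals_iff) auto
      fix e assume e: "e \<in> E"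
      then obtain a b where ab: "1 \<le> a" "a < b" "b \<le> n" "e = {a, b}" using ordered by blast
      show "\<not> crossing {1, p} e"
      proof
        assume "crossing {1, p} e"
        then have a: "1 < a" "a < p" "p < b" using ab pJ by (auto simp: crossing_pair_iff)
        show False
        proof (cases "b = n")
          case True
          then have "a \<in> J" using e ab by (simp add: J_def)
          then show False using p_min a by fastforce
        next
          case False
          then have "crossing e {p, n}" using a ab by (auto intro: crossingI)
          then show False using triangulations_ofD(2)[OF E e pJ(3)] by blast
        qed
      qed
    qed
    then show ?thesis by blast
  qed
  have q1: "{q, n - 1} \<in> polygon_sides n \<union> E"
  proof (cases "Suc q = n - 1")
    case True
    then show ?thesis using qJ pair_in_polygon_sides_iff[of q n "n - 1"] by simp
  next
    case False
    \<comment> \<open>The mirror argument: a crossing diagonal either joins \<open>n\<close> to a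
      vertex beyond \<open>q\<close>, against maximality of \<open>q\<close>, or crosses
      \<open>{q, n}\<close>.\<close>
    have "{q, n - 1} \<in> E"
    proof (rule triangulations_ofD(3)[OF E])
      show "{q, n - 1} \<in> polygon_diagonals n"
        using qJ False by (subst pair_in_polygon_diagonals_iff) auto
      fix e assume e: "e \<in> E"
      then obtain a b where ab: "1 \<le> a" "a < b" "b \<le> n" "e = {a, b}" using ordered by blast
      show "\<not> crossing {q, n - 1} e"
      proof
        assume "crossing {q, n - 1} e"
        then consider "q < a" "a < n - 1" "n - 1 < b" | "a < q" "q < b" "b < n - 1"
          using ab qJ by (auto simp: crossing_pair_iff)
        then show False
        proof cases
          case 1
          with ab have "b = n" by simp
          then have "a \<in> J" using e ab by (simp add: J_def)
          then show False using q_max 1 by fastforce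
        next
          case 2
          then have "crossing e {q, n}" using ab by (auto intro: crossingI)
          then show False using triangulations_ofD(2)[OF E e qJ(3)] by blast
        qed
      qed
    qed
    then show ?thesis by blast
  qed
  have tri: "{x, y, n} \<in> attached n E n"
    if "1 \<le> x" "x < y" "y < n" "{x, y} \<in> polygon_sides n \<union> E" "{x, n} \<in> polygon_sides n \<union> E"
      "{y, n} \<in> polygon_sides n \<union> E" for x y
  proof -
    have "e \<in> {{x, y}, {x, n}, {y, n}}" if "e \<subseteq> {x, y, n}" "card e = 2" for e
      using that unfolding card_2_iff by (auto simp: doubleton_eq_iff)
    then have "e \<in> polygon_sides n \<union> E" if "e \<subseteq> {x, y, n}" "card e = 2" for e
      using that \<open>{x, y} \<in> _\<close> \<open>{x, n} \<in> _\<close> \<open>{y, n} \<in> _\<close> by blast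
    moreover have "{x, y, n} \<subseteq> {1..n}" "card {x, y, n} = 3" using that by auto
    ultimately show ?thesis unfolding attached_def triangles_def by blast
  qed
  have "{1, n} \<in> polygon_sides n" "{n - 1, n} \<in> polygon_sides n"
    using pJ pair_in_polygon_sides_iff[of 1 n n] pair_in_polygon_sides_iff[of "n - 1" n n] by auto
  then have "{1, p, n} \<in> attached n E n" "{q, n - 1, n} \<in> attached n E n"
    using tri[of 1 p] tri[of q "n - 1"] p1 q1 pJ qJ by auto
  then have "card {{1, p, n}, {q, n - 1, n}} \<le> card (attached n E n)"
    by (intro card_mono finite_attached) simp
  \<comment> \<open>Vertex 1 tells the two triangles apart, even when \<open>p\<close> and
    \<open>q\<close> coincide.\<close>
  moreover have "1 \<notin> {q, n - 1, n}" using pJ qJ by auto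
  then have "{1, p, n} \<noteq> {q, n - 1, n}" by blast
  ultimately show ?thesis by simp
qed

lemma ex_ear:
  assumes n: "n \<ge> 4" and E: "E \<in> triangulations_of n"
  obtains v where "v \<in> {1..n}" "\<And>d. d \<in> E \<Longrightarrow> v \<notin> d"
proof -
  have pair: "{i, k} \<in> E \<Longrightarrow> i < k \<Longrightarrow> 1 \<le> i \<and> Suc i < k \<and> k \<le> n \<and> (i \<noteq> 1 \<or> k \<noteq> n)" for i k
    using triangulations_ofD(1)[OF E] pair_in_polygon_diagonals_iff by blast
  have "E \<noteq> {}"
  proof
    assume "E = {}"
    moreover have "{1, 3} \<in> polygon_diagonals n"
      using n pair_in_polygon_diagonals_iff[of 1 3 n] by auto
    ultimately show False using triangulations_ofD(3)[OF E] by blast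
  qed
  then obtain e where "e \<in> E" by blast
  then obtain i0 k0 where "i0 < k0" "{i0, k0} \<in> E"
    using triangulations_ofD(1)[OF E] by (metis polygon_diagonals_ordered Suc_lessD subsetD)
  then have "\<exists>l i. {i, i + l} \<in> E \<and> l > 0"
    by (intro exI[of _ "k0 - i0"] exI[of _ i0]) simp
  \<comment> \<open>Length is the plain difference of the labels, not the cyclic distance; this is
    enough, as the ear is sought between the two labels.\<close>
  define l where "l = (LEAST l. \<exists>i. {i, i + l} \<in> E \<and> l > 0)"
  from \<open>\<exists>l i. _\<close> have "\<exists>i. {i, i + l} \<in> E \<and> l > 0"
    unfolding l_def by (rule LeastI_ex)
  then obtain i where i: "{i, i + l} \<in> E" "l > 0" by blast
  have min: "l \<le> k - j" if "{j, k} \<in> E" "j < k" for j k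
    unfolding l_def by (rule Least_le) (use that in \<open>auto intro!: exI[of _ j]\<close>)
  have il: "1 \<le> i" "Suc i < i + l" "i + l \<le> n" using pair[OF i(1)] i(2) by auto
  show ?thesis
  proof (rule that)
    show "Suc i \<in> {1..n}" using il by simp
    fix d assume d: "d \<in> E"
    show "Suc i \<notin> d"
    proof
      assume "Suc i \<in> d"
      obtain x y where xy: "x < y" "d = {x, y}"
        using d triangulations_ofD(1)[OF E] by (metis polygon_diagonals_ordered Suc_lessD subsetD)
      \<comment> \<open>A diagonal from \<open>Suc i\<close> to a larger label up to
        \<open>i + l\<close> would be shorter than \<open>l\<close>. Any other one crosses
        \<open>{i, i + l}\<close>, since \<open>i\<close> itself is joined to \<open>Suc i\<close>
        by a side.\<close>
      have "\<not> crossing {i, i + l} {x, y}" using triangulations_ofD(2)[OF E i(1) d] xy by simp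
      then show False
        using \<open>Suc i \<in> d\<close> xy il pair[of x y] d min[of x y] by (auto simp: crossing_pair_iff)
    qed
  qed
qed

subsection \<open>The bijection\<close>

lemma nth_rotate1_rotate_vertex:
  "i \<in> {1..length c} \<Longrightarrow> rotate1 c ! (rotate_vertex (length c) i - 1) = c ! (i - 1)"
  by (cases c; cases i) (auto simp: rotate_vertex_def nth_append nth_Cons split: nat.split)

lemma nth_rev_reflect_vertex:
  "i \<in> {1..length c} \<Longrightarrow> rev c ! (reflect_vertex (length c) i - 1) = c ! (i - 1)"
  by (auto simp: reflect_vertex_def rev_nth)

text \<open>Conjugation by a reflection inverts a rotation. This yields inverse rotations from the
  two given generators, so that statements closed under both become invariant under
  \<open>rotate1\<close> in both directions.\<close>

lemma rev_rotate1_rev_rotate1: "rev (rotate1 (rev (rotate1 c))) = c"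
  by (cases c) simp_all

lemma ex1_realizes_rotate1: "\<exists>!D. realizes D c \<Longrightarrow> \<exists>!D. realizes D (rotate1 c)"
  by (rule polygon_symmetry_ex1_realizes[OF polygon_symmetry_rotate_vertex])
    (auto simp only: length_rotate1 nth_rotate1_rotate_vertex)

lemma ex1_realizes_rev: "\<exists>!D. realizes D c \<Longrightarrow> \<exists>!D. realizes D (rev c)"
  by (rule polygon_symmetry_ex1_realizes[OF polygon_symmetry_reflect_vertex])
    (auto simp only: length_rev nth_rev_reflect_vertex)

lemma ex1_realizes_rotate1_iff: "(\<exists>!D. realizes D (rotate1 c)) \<longleftrightarrow> (\<exists>!D. realizes D c)"
proof
  assume "\<exists>!D. realizes D (rotate1 c)"
  then have "\<exists>!D. realizes D (rev (rotate1 (rev (rotate1 c))))"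
    by (rule ex1_realizes_rev[OF ex1_realizes_rotate1[OF ex1_realizes_rev]])
  then show "\<exists>!D. realizes D c" by (simp only: rev_rotate1_rev_rotate1)
qed (rule ex1_realizes_rotate1)

lemma rotate1_in_eta_sequences_iff: "rotate1 c \<in> eta_sequences \<longleftrightarrow> c \<in> eta_sequences"
proof
  assume "rotate1 c \<in> eta_sequences"
  then have "rev (rotate1 (rev (rotate1 c))) \<in> eta_sequences"
    by (rule eta_sequences.reflect[OF eta_sequences.rotate[OF eta_sequences.reflect]])
  then show "c \<in> eta_sequences" by (simp only: rev_rotate1_rev_rotate1)
qed (rule eta_sequences.rotate)

section \<open>Every \<eta>-sequence is realized by exactly one triangulation\<close>

lemma length_eta_sequence: "c \<in> eta_sequences \<Longrightarrow> length c \<ge> 3"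
  by (induction rule: eta_sequences.induct) auto

lemma polygon_diagonals_3: "polygon_diagonals 3 = {}"
proof -
  have False if "d \<in> polygon_diagonals 3" for d
    using that by (rule polygon_diagonals_ordered) auto
  then show ?thesis by blast
qed

lemma triangulations_of_3: "triangulations_of 3 = {{}}"
  by (auto simp: triangulations_of_def polygon_diagonals_3)

lemma realizes_triangle: "realizes {} [1, 1, 1]"
proof -
  have "triangles 3 {} = {{1..3}}"
  proof (intro equalityI subsetI)
    fix t assume "t \<in> triangles 3 {}"
    then have "t = {1..3}" by (intro card_subset_eq) (auto simp: triangles_def)
    then show "t \<in> {{1..3}}" by simp
  next
    fix t :: "nat set" assume "t \<in> {{1..3}}"
    moreover have "e \<in> polygon_sides 3" if "e \<subseteq> {1..3}" "card e = 2" for e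
      using that polygon_diagonals_3 unfolding polygon_diagonals_def by blast
    ultimately show "t \<in> triangles 3 {}" by (simp add: triangles_def)
  qed
  then have "attached 3 {} i = {{1..3}}" if "i \<in> {1..3}" for i
    using that unfolding attached_def by auto
  moreover have "[1, 1, 1 :: nat] ! (i - 1) = 1" if "i \<in> {1..3}" for i
    using that by (auto simp: nth_Cons split: nat.split)
  ultimately show ?thesis
    by (simp add: realizes_def triangulations_of_3 numeral_3_eq_3[symmetric])
qed

lemma ex1_realizes_attach_ear:
  assumes n: "length c \<ge> 1" and ex1: "\<exists>!D. realizes D (b # c @ [a])"
  shows "\<exists>!E. realizes E (Suc b # c @ [Suc a, 1])"
proof -
  let ?n = "Suc (Suc (length c))"
  obtain D where D: "realizes D (b # c @ [a])"
    and uniq: "\<And>D'. realizes D' (b # c @ [a]) \<Longrightarrow> D' = D" using ex1 by blast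
  have tri: "D \<in> triangulations_of ?n" using realizes_triangulations_of[OF D] by simp
  show ?thesis
  proof (rule ex1I)
    show "realizes (insert {1, ?n} D) (Suc b # c @ [Suc a, 1])"
      using D realizes_attach_ear_iff[OF n tri] by blast
  next
    fix E assume E: "realizes E (Suc b # c @ [Suc a, 1])"
    then have triE: "E \<in> triangulations_of (Suc ?n)"
      using realizes_triangulations_of by fastforce
    \<comment> \<open>Any competitor \<open>E\<close> also has count 1 at the last vertex, so no
      diagonal of \<open>E\<close> can end there and \<open>E\<close> arises by attaching an
      ear.\<close>
    have "card (attached (Suc ?n) E (Suc ?n)) = 1"
      using E by (simp add: realizes_def nth_append)
    then have ear: "Suc ?n \<notin> d" if "d \<in> E" for d
      using card_attached_last_ge_2[OF triE that] by auto
    obtain D' where D': "D' \<in> triangulations_of ?n" "E = insert {1, ?n} D'"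
      by (rule triangulations_of_remove_ear[OF _ triE ear]) (use n in auto)
    then have "realizes D' (b # c @ [a])" using E realizes_attach_ear_iff[OF n] by blast
    then show "E = insert {1, ?n} D" using uniq D' by blast
  qed
qed

lemma eta_sequence_ex1_realizes:
  assumes "c \<in> eta_sequences"
  shows "\<exists>!D. realizes D c"
  using assms
proof induction
  case base
  show ?case
  proof (rule ex1I)
    show "realizes {} [1, 1, 1]" by (rule realizes_triangle)
  next
    fix D assume "realizes D [1, 1, 1]"
    then have "D \<in> triangulations_of 3"
      using realizes_triangulations_of by (fastforce simp: numeral_3_eq_3)
    then show "D = {}" by (simp add: triangulations_of_3)
  qed
next
  case (rotate c)
  then show ?case by (intro ex1_realizes_rotate1)
next
  case (reflect c)
  then show ?case by (intro ex1_realizes_rev)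
next
  case (insert_one a b c)
  have "length c \<ge> 1" using length_eta_sequence[OF insert_one.hyps] by simp
  moreover have "\<exists>!D. realizes D (b # c @ [a])"
    using ex1_realizes_rotate1[OF insert_one.IH] by simp
  ultimately have "\<exists>!E. realizes E (Suc b # c @ [Suc a, 1])" by (rule ex1_realizes_attach_ear)
  \<comment> \<open>The inserted 1 is moved from the last place back to the second by undoing two
    rotations.\<close>
  also have "Suc b # c @ [Suc a, 1] = rotate1 (rotate1 ((a + 1) # 1 # (b + 1) # c))" by simp
  finally show ?case by (simp only: ex1_realizes_rotate1_iff)
qed

section \<open>Every triangulation realizes an \<eta>-sequence\<close>

lemma eta_sequence_attach_ear:
  assumes "b # c @ [a] \<in> eta_sequences"
  shows "Suc b # c @ [Suc a, 1] \<in> eta_sequences"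
proof -
  have "rotate1 (a # b # c) \<in> eta_sequences" using assms by simp
  then have "(a + 1) # 1 # (b + 1) # c \<in> eta_sequences"
    unfolding rotate1_in_eta_sequences_iff by (rule eta_sequences.insert_one)
  then have "rotate1 (rotate1 ((a + 1) # 1 # (b + 1) # c)) \<in> eta_sequences"
    by (simp only: rotate1_in_eta_sequences_iff)
  then show ?thesis by simp
qed

lemma triangulation_realizes_eta_sequence:
  assumes "n \<ge> 3" "E \<in> triangulations_of n"
  shows "\<exists>c\<in>eta_sequences. length c = n \<and> realizes E c"
  using assms
proof (induction n arbitrary: E rule: nat_induct_at_least)
  case base
  then show ?case using eta_sequences.base realizes_triangle
    by (intro bexI[of _ "[1, 1, 1]"]) (auto simp: triangulations_of_3)
next
  case (Suc n)
  have last: "\<exists>c\<in>eta_sequences. length c = Suc n \<and> realizes E c"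
    if E: "E \<in> triangulations_of (Suc n)" and ear: "\<And>d. d \<in> E \<Longrightarrow> Suc n \<notin> d" for E
  proof -
    obtain D where D: "D \<in> triangulations_of n" "E = insert {1, n} D"
      by (rule triangulations_of_remove_ear[OF Suc.hyps E ear])
    from Suc.IH[OF D(1)] obtain c where c: "c \<in> eta_sequences" "length c = n" "realizes D c"
      by blast
    obtain b c' where "c = b # c'" using c(2) Suc.hyps by (metis list.size(3) neq_Nil_conv not_numeral_le_zero)
    moreover from this c(2) Suc.hyps have "c' \<noteq> []" by auto
    then obtain r a where "c' = r @ [a]" by (metis rev_exhaust)
    ultimately have cr: "c = b # r @ [a]" by simp
    with c Suc.hyps have n: "length r \<ge> 1" "n = Suc (Suc (length r))" by auto
    have "realizes E (Suc b # r @ [Suc a, 1])"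
      using realizes_attach_ear_iff[of r D b a] n c D unfolding cr by simp
    moreover have "Suc b # r @ [Suc a, 1] \<in> eta_sequences"
      using c(1) unfolding cr by (rule eta_sequence_attach_ear)
    moreover have "length (Suc b # r @ [Suc a, 1]) = Suc n" using n by simp
    ultimately show ?thesis by blast
  qed
  \<comment> \<open>An ear at an arbitrary vertex \<open>v\<close> is pushed up to
    \<open>Suc n\<close> one label at a time. The induction runs downwards from \<open>Suc n\<close>
    and has to vary \<open>E\<close>, since each step relabels the triangulation.\<close>
  have rotated: "\<exists>c\<in>eta_sequences. length c = Suc n \<and> realizes E c"
    if "v \<le> Suc n" "1 \<le> v" "E \<in> triangulations_of (Suc n)" "\<And>d. d \<in> E \<Longrightarrow> v \<notin> d" for v E
    using that
  proof (induction v arbitrary: E rule: inc_induct)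
    case base
    then show ?case using last by blast
  next
    case (step v)
    let ?s = "rotate_vertex (Suc n)" let ?t = "inv_into {1..Suc n} ?s"
    \<comment> \<open>Rotating \<open>E\<close> backwards turns its ear \<open>v\<close> into the
      ear \<open>Suc v\<close> of \<open>?F\<close>; a sequence found for \<open>?F\<close> is
      brought back to \<open>E\<close> by \<open>rotate1\<close>.\<close>
    let ?F = "(`) ?t ` E"
    have sym: "polygon_symmetry (Suc n) ?s" by (rule polygon_symmetry_rotate_vertex)
    then have b: "bij_betw ?s {1..Suc n} {1..Suc n}" by (simp add: polygon_symmetry_def)
    have st: "?s ` ?t ` d = d" if "d \<in> E" for d
      using triangulations_of_subset_vertices[OF step.prems(2) that] b
      by (simp only: bij_betw_def image_inv_into_cancel)
    have "\<exists>c\<in>eta_sequences. length c = Suc n \<and> realizes ?F c"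
    proof (rule step.IH)
      show "?F \<in> triangulations_of (Suc n)"
        using polygon_symmetry_triangulations_of[OF polygon_symmetry_inv_into[OF sym] step.prems(2)] .
      fix d assume "d \<in> ?F"
      then obtain e where e: "e \<in> E" "d = ?t ` e" by blast
      show "Suc v \<notin> d"
      proof
        assume "Suc v \<in> d"
        then have "?s (Suc v) \<in> ?s ` ?t ` e" using e by blast
        \<comment> \<open>Since \<open>v\<close> is at least 1, \<open>Suc v\<close> is not the
          vertex that wraps around.\<close>
        moreover have "?s (Suc v) = v" using step.prems(1) by (simp add: rotate_vertex_def)
        ultimately have "v \<in> e" using st[OF e(1)] by simp
        then show False using step.prems(3) e by blast
      qed
    qed simp
    then obtain c where c: "c \<in> eta_sequences" "length c = Suc n" "realizes ?F c" by blast
    have "realizes ((`) ?s ` ?F) (rotate1 c)"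
      by (rule polygon_symmetry_realizes[OF _ c(3)])
        (use sym c(2) nth_rotate1_rotate_vertex[of _ c] in simp_all)
    moreover have "(`) ?s ` ?F = E" using st by (simp add: image_image)
    ultimately have "realizes E (rotate1 c)" by simp
    then show ?case using c eta_sequences.rotate[of c] by (intro bexI[of _ "rotate1 c"]) simp_all
  qed
  obtain v where v: "v \<in> {1..Suc n}" and ear: "\<And>d. d \<in> E \<Longrightarrow> v \<notin> d"
    by (rule ex_ear[OF _ Suc.prems]) (use Suc.hyps in auto)
  show ?case by (rule rotated[OF _ _ Suc.prems ear]) (use v in simp_all)
qed

lemma realizes_same_length_unique:
  assumes "realizes D c" "realizes D c'" "length c = length c'"
  shows "c = c'"
proof (rule nth_equalityI)
  fix i assume "i < length c"
  then have "Suc i \<in> {1..length c}" by simp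
  then show "c ! i = c' ! i" using assms unfolding realizes_def by (metis diff_Suc_1)
qed (rule assms)

theorem theorem3p4:
  shows "(\<forall>c\<in>eta_sequences. \<exists>!D. realizes D c) \<and> bij_betw Psi eta_sequences triangulations"
proof
  show ex1: "\<forall>c\<in>eta_sequences. \<exists>!D. realizes D c"
    using eta_sequence_ex1_realizes by blast
  \<comment> \<open>Unique existence gives the definite description in \<open>Psi\<close> its
    meaning; from here on only \<open>realizes\<close> matters.\<close>
  have real: "realizes (snd (Psi c)) c" if "c \<in> eta_sequences" for c
    using theI'[OF bspec[OF ex1 that]] by (simp add: Psi_def)
  show "bij_betw Psi eta_sequences triangulations"
    unfolding bij_betw_def
  proof
    show "inj_on Psi eta_sequences"
    proof (rule inj_onI)
      fix c c' assume c: "c \<in> eta_sequences" "c' \<in> eta_sequences" "Psi c = Psi c'"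
      from c(3) have "length c = length c'" by (simp add: Psi_def)
      with c show "c = c'" using real realizes_same_length_unique by metis
    qed
    show "Psi ` eta_sequences = triangulations"
    proof (intro equalityI subsetI)
      fix x assume "x \<in> Psi ` eta_sequences"
      then obtain c where c: "c \<in> eta_sequences" "x = Psi c" by blast
      then have "x = (length c, snd (Psi c))" by (simp add: Psi_def)
      with realizes_triangulations_of[OF real[OF c(1)]] length_eta_sequence[OF c(1)]
      show "x \<in> triangulations" by (simp add: triangulations_def)
    next
      fix x assume "x \<in> triangulations"
      then obtain n E where x: "x = (n, E)" "n \<ge> 3" "E \<in> triangulations_of n"
        by (auto simp: triangulations_def)
      then obtain c where c: "c \<in> eta_sequences" "length c = n" "realizes E c"
        using triangulation_realizes_eta_sequence by blast
      \<comment> \<open>Both triangulations realize \<open>c\<close>, so they agree by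
        uniqueness.\<close>
      then have "snd (Psi c) = E" using real ex1 by blast
      then have "x = Psi c" using x c by (simp add: Psi_def)
      then show "x \<in> Psi ` eta_sequences" using c by blast
    qed
  qed
qed

end
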